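(* For each $n\in\mathbb{N}$ let $G=G_n$ be a simple graph on $[n]$ and let $d=d_n$ be a positive integer. Suppose that $d\ll \mathsf{maxdeg}(G)$ as $n\to\infty$. Then $\mathsf{TV}(\kappa_r(W(G,d)),\kappa_r(M(G)))\to 1$ as $n\to\infty$. In particular, $\mathsf{TV}(W(G,d),M(G))\to 1$.
   Context: Masked Wishart law: for a graph $G$ on $[n]$ with adjacency matrix $A_G$, $W(G,d)$ is the law of $A_G\odot \bigl(d^{-1/2}(X^\top X-dI_n)\bigr)$, where $X\in\mathbb{R}^{d\times n}$ has i.i.d. standard Gaussian entries and $\odot$ is the entrywise (Schur) product. Masked GOE law: $M(G)$ is the law of $A_G\odot M$, where $M$ is an $n\times n$ GOE matrix, i.e. a symmetric matrix with standard Gaussian off-diagonal entries, $\mathcal N(0,2)$ diagonal entries, and mutually independent entries on or above the diagonal. $\mathsf{TV}$ is total variation distance. $N(v)$ is the set of neighbors of $v$ in $G$, $\mathsf{maxdeg}(G)=\max_{v\in G}|N(v)|$, and $v^*$ is a vertex of maximal degree, ties broken in an arbitrary but deterministic way (e.g. smallest label). The longest row statistic $\kappa_r:\mathbb{R}^{n\times n}\to\mathbb{R}$ is \[ \kappa_r(M)=\frac{1}{\mathsf{maxdeg}(G)}\sum_{i\in N(v^* )}M_{v^*,i}^2 . \] For a law $\mu$ on $\mathbb{R}^{n\times n}$, $\kappa_r(\mu)$ denotes the law of $\kappa_r(M)$ for $M\sim\mu$. Asymptotics: $f(n)\ll g(n)$ means $\lim_{n\to\infty} g(n)/f(n)=\infty$.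 *)

theory Defs
  imports "HOL-Probability.Probability" "Graph_Theory.Pair_Digraph"
begin

section \<open>Graphs\<close>

text \<open>
  A simple graph is a finite symmetric loop-free digraph without parallel arcs
  (\<^locale>\<open>pair_graph\<close>): an edge between u and v is the pair of arcs (u,v), (v,u).
\<close>

definition neighbors :: "'a pair_pre_digraph \<Rightarrow> 'a \<Rightarrow> 'a set" where
  "neighbors G v = {u. (v, u) \<in> parcs G}"

definition maxdeg :: "'a pair_pre_digraph \<Rightarrow> nat" where
  "maxdeg G = Max ((\<lambda>v. card (neighbors G v)) ` pverts G)"

definition max_degree_vertex :: "'a pair_pre_digraph \<Rightarrow> 'a \<Rightarrow> bool" where
  "max_degree_vertex G v \<longleftrightarrow> v \<in> pverts G \<and> card (neighbors G v) = maxdeg G"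

section \<open>Matrices and their laws\<close>

text \<open>
  A real matrix with rows indexed by U and columns indexed by V is an extensional function
  on U \<times> V; the space of V \<times> V matrices carries the product (i.e. the Borel) sigma-algebra.
\<close>

type_synonym 'a rmatrix = "'a \<times> 'a \<Rightarrow> real"

definition matrix_space :: "'a set \<Rightarrow> 'a rmatrix measure" where
  "matrix_space V = (\<Pi>\<^sub>M p\<in>V \<times> V. borel)"

definition schur :: "'a set \<Rightarrow> 'a rmatrix \<Rightarrow> 'a rmatrix \<Rightarrow> 'a rmatrix" where
  "schur V A B = (\<lambda>p\<in>V \<times> V. A p * B p)"

definition adj_matrix :: "'a pair_pre_digraph \<Rightarrow> 'a rmatrix" where
  "adj_matrix G = (\<lambda>p\<in>pverts G \<times> pverts G. if p \<in> parcs G then 1 else 0)"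

definition gaussian_matrix :: "nat \<Rightarrow> nat set \<Rightarrow> nat rmatrix measure" where
  "gaussian_matrix d V = (\<Pi>\<^sub>M p\<in>{1..d} \<times> V. std_normal_distribution)"

text \<open>The entries of the V \<times> V matrix d^(-1/2) (X^T X - d I), for X a d \<times> V matrix.\<close>

definition normalized_gram :: "nat \<Rightarrow> nat set \<Rightarrow> nat rmatrix \<Rightarrow> nat rmatrix" where
  "normalized_gram d V X = (\<lambda>(i, j)\<in>V \<times> V.
     1 / sqrt (real d) * ((\<Sum>k\<in>{1..d}. X (k, i) * X (k, j)) - real d * (if i = j then 1 else 0)))"

text \<open>
  The second argument of \<^const>\<open>normal_density\<close> is the standard deviation, so the diagonal
  entries below have variance 2.
\<close>

definition goe_upper :: "nat set \<Rightarrow> nat rmatrix measure" where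
  "goe_upper V = (\<Pi>\<^sub>M p\<in>{(i, j) \<in> V \<times> V. i \<le> j}.
     density lborel (normal_density 0 (if fst p = snd p then sqrt 2 else 1)))"

definition symmetrize :: "nat set \<Rightarrow> nat rmatrix \<Rightarrow> nat rmatrix" where
  "symmetrize V Z = (\<lambda>(i, j)\<in>V \<times> V. Z (min i j, max i j))"

definition GOE :: "nat set \<Rightarrow> nat rmatrix measure" where
  "GOE V = distr (goe_upper V) (matrix_space V) (symmetrize V)"

definition masked_wishart :: "nat pair_pre_digraph \<Rightarrow> nat \<Rightarrow> nat rmatrix measure" where
  "masked_wishart G d = distr (gaussian_matrix d (pverts G)) (matrix_space (pverts G))
     (\<lambda>X. schur (pverts G) (adj_matrix G) (normalized_gram d (pverts G) X))"

definition masked_goe :: "nat pair_pre_digraph \<Rightarrow> nat rmatrix measure" where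
  "masked_goe G = distr (GOE (pverts G)) (matrix_space (pverts G))
     (\<lambda>M. schur (pverts G) (adj_matrix G) M)"

section \<open>Longest row statistic\<close>

text \<open>The argument v is the chosen vertex of maximal degree.\<close>

definition kappa_r :: "'a pair_pre_digraph \<Rightarrow> 'a \<Rightarrow> 'a rmatrix \<Rightarrow> real" where
  "kappa_r G v M = 1 / real (maxdeg G) * (\<Sum>i\<in>neighbors G v. (M (v, i))\<^sup>2)"

definition kappa_r_law :: "'a pair_pre_digraph \<Rightarrow> 'a \<Rightarrow> 'a rmatrix measure \<Rightarrow> real measure" where
  "kappa_r_law G v \<mu> = distr \<mu> borel (kappa_r G v)"

section \<open>Total variation distance\<close>

text \<open>Intended for probability measures with the same sigma-algebra.\<close>

definition total_variation :: "'a measure \<Rightarrow> 'a measure \<Rightarrow> real" where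
  "total_variation \<mu> \<nu> = (SUP A\<in>sets \<mu>. \<bar>measure \<mu> A - measure \<nu> A\<bar>)"

section \<open>The maps above are measurable and the laws are probability measures\<close>

lemma measurable_schur [measurable]: "schur V A \<in> measurable (matrix_space V) (matrix_space V)"
  unfolding schur_def matrix_space_def by measurable

lemma measurable_normalized_gram [measurable]:
  "normalized_gram d V \<in> measurable (gaussian_matrix d V) (matrix_space V)"
  unfolding normalized_gram_def matrix_space_def gaussian_matrix_def
  by (rule measurable_restrict)
     (auto intro!: borel_measurable_times borel_measurable_diff borel_measurable_sum
        measurable_compose[OF measurable_component_singleton[where M = "\<lambda>_. std_normal_distribution"]])

lemma measurable_symmetrize [measurable]:
  "symmetrize V \<in> measurable (goe_upper V) (matrix_space V)"
  unfolding symmetrize_def matrix_space_def goe_upper_def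
proof (rule measurable_restrict, clarify)
  fix i j assume "i \<in> V" "j \<in> V"
  then have "(min i j, max i j) \<in> {(i, j) \<in> V \<times> V. i \<le> j}"
    by (auto simp: min_def max_def)
  from measurable_component_singleton[OF this,
      of "\<lambda>p. density lborel (normal_density 0 (if fst p = snd p then sqrt 2 else 1))"]
  show "(\<lambda>x. x (min i j, max i j)) \<in> borel_measurable
      (\<Pi>\<^sub>M p\<in>{(i, j) \<in> V \<times> V. i \<le> j}.
         density lborel (normal_density 0 (if fst p = snd p then sqrt 2 else 1)))"
    by (simp cong: measurable_cong_sets)
qed

lemma measurable_kappa_r:
  assumes "pair_graph G" "v \<in> pverts G"
  shows "kappa_r G v \<in> borel_measurable (matrix_space (pverts G))"
proof -
  interpret pair_graph G by fact
  show ?thesis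
    unfolding kappa_r_def matrix_space_def neighbors_def
    by (intro borel_measurable_times borel_measurable_const borel_measurable_sum
        borel_measurable_power measurable_component_singleton)
       (use assms(2) in_arcsD2 in auto)
qed

lemma prob_space_gaussian_matrix: "prob_space (gaussian_matrix d V)"
  unfolding gaussian_matrix_def by (intro prob_space_PiM prob_space_normal_density) simp

lemma prob_space_GOE: "prob_space (GOE V)"
  unfolding GOE_def
proof (rule prob_space.prob_space_distr[OF _ measurable_symmetrize])
  show "prob_space (goe_upper V)"
    unfolding goe_upper_def by (intro prob_space_PiM prob_space_normal_density) simp
qed

lemma prob_space_masked_wishart: "prob_space (masked_wishart G d)"
  unfolding masked_wishart_def
  by (rule prob_space.prob_space_distr[OF prob_space_gaussian_matrix]) measurable

lemma prob_space_masked_goe: "prob_space (masked_goe G)"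
  unfolding masked_goe_def
  by (rule prob_space.prob_space_distr[OF prob_space_GOE]) (simp add: GOE_def)

end

theory Submission
  imports Defs
begin

text \<open>
  Write \<open>\<Delta>\<close> for the maximal degree. Under the masked GOE law the longest row statistic is the
  average of \<open>\<Delta>\<close> squares of independent standard Gaussians, so it has mean 1 and fluctuations of
  order \<open>\<Delta>\<^sup>-\<^sup>1\<^sup>/\<^sup>2\<close>. Under the masked Wishart law it carries the factor \<open>\<bar>X\<^sub>v\<bar>\<^sup>2 / d\<close>, where \<open>X\<^sub>v\<close> is the
  Gaussian column of the chosen vertex \<open>v\<close>, and this factor fluctuates at the much larger scale
  \<open>d\<^sup>-\<^sup>1\<^sup>/\<^sup>2\<close>. Hence the interval of logarithmic length \<open>1 / (K \<surd>d)\<close> around 1 has GOE probability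
  tending to 1 for every fixed \<open>K\<close>, by Chebyshev's inequality (\<open>kappa_r_goe_concentration\<close>), while
  its Wishart probability is at most a constant multiple of \<open>1 / K\<close> (\<open>kappa_r_wishart_interval\<close>).
  Sending \<open>n\<close> and then \<open>K\<close> to infinity separates the two laws, and the claim for the matrices
  themselves follows because a measurable map cannot increase total variation distance.

  The Wishart bound is anticoncentration without any chi-square density. The entries of row \<open>v\<close>
  are linear in \<open>X\<^sub>v\<close>, so the statistic is homogeneous of degree 2 in that column, whatever the other
  columns are. Multiplying the column by \<open>e\<^sup>u\<^sup>/\<^sup>2\<close> moves the event that the statistic lies in
  \<open>[a, a e\<^sup>h)\<close> to the same event for \<open>[a e\<^sup>u, a e\<^sup>u\<^sup>+\<^sup>h)\<close>, and for \<open>u = 0, h, \<dots>, (K - 1) h\<close> these \<open>K\<close>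
  events are disjoint. The Gaussian probability of a moved event is the integral over the original
  event of the density \<open>exp ((d u - (e\<^sup>u - 1) \<bar>X\<^sub>v\<bar>\<^sup>2) / 2)\<close> (\<open>distr_std_gaussian_scale\<close>). Where
  \<open>\<bar>X\<^sub>v\<bar>\<^sup>2 \<le> d\<close> this density is at least \<open>exp (- d u\<^sup>2 / 2)\<close>, hence at least \<open>e\<^sup>-\<^sup>1\<^sup>/\<^sup>2\<close> as long as
  \<open>0 \<le> u \<le> d\<^sup>-\<^sup>1\<^sup>/\<^sup>2\<close>; where \<open>\<bar>X\<^sub>v\<bar>\<^sup>2 > d\<close> the column is shrunk instead. So \<open>K\<close> disjoint events each carry at least a fixed fraction of the probability of
  the original one (\<open>interval_prob_le_of_density_bound\<close>, \<open>interval_prob_le\<close>).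
\<close>

section \<open>Dilations of Gaussian coordinates\<close>

abbreviation std_gaussian :: "'i set \<Rightarrow> ('i \<Rightarrow> real) measure" where
  "std_gaussian I \<equiv> \<Pi>\<^sub>M i\<in>I. std_normal_distribution"

definition scale_on :: "'i set \<Rightarrow> real \<Rightarrow> ('i \<Rightarrow> real) \<Rightarrow> 'i \<Rightarrow> real" where
  "scale_on J c x = (\<lambda>i. if i \<in> J then c * x i else x i)"

lemma distr_std_normal_scale:
  "distr std_normal_distribution borel ((*) (exp (- u / 2))) =
     density std_normal_distribution (\<lambda>x. ennreal (exp ((u - (exp u - 1) * x\<^sup>2) / 2)))"
proof -
  let ?c = "exp (- u / 2)"
  have "prob_space std_normal_distribution"
    by (rule prob_space_normal_density) simp
  then interpret prob_space std_normal_distribution .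
  have "distributed std_normal_distribution lborel (\<lambda>x. x) (normal_density 0 1)"
    by (auto simp: distributed_def distr_id2)
  from normal_density_affine[OF this, of ?c 0]
  have *: "distr std_normal_distribution lborel (\<lambda>x. ?c * x) = density lborel (normal_density 0 ?c)"
    by (auto simp: distributed_def)
  have "normal_density 0 ?c x = std_normal_density x * exp ((u - (exp u - 1) * x\<^sup>2) / 2)" for x
  proof -
    have e: "?c\<^sup>2 = exp (- u)"
      by (simp add: power2_eq_square flip: exp_add)
    have s: "sqrt (2 * pi * exp (- u)) = sqrt (2 * pi) * ?c"
      by (simp add: real_sqrt_mult real_sqrt_unique[OF e])
    have "- x\<^sup>2 / (2 * exp (- u)) = - u / 2 + (- x\<^sup>2 / 2 + (u - (exp u - 1) * x\<^sup>2) / 2)"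
      by (simp add: exp_minus field_simps)
    then have "exp (- x\<^sup>2 / (2 * exp (- u))) = ?c * (exp (- x\<^sup>2 / 2) * exp ((u - (exp u - 1) * x\<^sup>2) / 2))"
      by (simp only: exp_add)
    then show ?thesis
      unfolding normal_density_def e s by simp
  qed
  then have "density lborel (normal_density 0 ?c) =
      density std_normal_distribution (\<lambda>x. ennreal (exp ((u - (exp u - 1) * x\<^sup>2) / 2)))"
    by (subst density_density_eq) (auto simp: ennreal_mult intro!: density_cong)
  moreover have "distr std_normal_distribution borel ((*) ?c) = distr std_normal_distribution lborel (\<lambda>x. ?c * x)"
    by (rule distr_cong) auto
  ultimately show ?thesis using * by simp
qed

lemma measurable_scale_on:
  assumes "J \<subseteq> I"
  shows "scale_on J c \<in> measurable (std_gaussian I) (std_gaussian I)"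
proof (rule measurable_PiM_single')
  fix i assume "i \<in> I"
  then have "(\<lambda>x. x i) \<in> borel_measurable (std_gaussian I)"
    using measurable_component_singleton[of i I "\<lambda>_. std_normal_distribution"] by simp
  then show "(\<lambda>x. scale_on J c x i) \<in> measurable (std_gaussian I) std_normal_distribution"
    by (cases "i \<in> J") (auto simp: scale_on_def)
next
  show "scale_on J c \<in> space (std_gaussian I) \<rightarrow> (\<Pi>\<^sub>E i\<in>I. space std_normal_distribution)"
    using assms by (auto simp: scale_on_def space_PiM PiE_def extensional_def)
qed

text \<open>
  Both sides are product measures, because the weight on the right is a product over the
  coordinates in \<open>J\<close>; the statement is thus reduced to one dimension, factor by factor.
\<close>

lemma distr_std_gaussian_scale:
  assumes "finite I" "J \<subseteq> I"
  shows "distr (std_gaussian I) (std_gaussian I) (scale_on J (exp (- u / 2))) =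
     density (std_gaussian I) (\<lambda>x. ennreal (exp (\<Sum>j\<in>J. (u - (exp u - 1) * (x j)\<^sup>2) / 2)))"
    (is "?L = ?R")
proof -
  let ?c = "exp (- u / 2)"
  let ?w = "\<lambda>i x. if i \<in> J then ennreal (exp ((u - (exp u - 1) * x\<^sup>2) / 2)) else 1"
  let ?N = "\<lambda>i. if i \<in> J then distr std_normal_distribution borel ((*) ?c) else std_normal_distribution"
  have P: "prob_space std_normal_distribution" by (rule prob_space_normal_density) simp
  interpret G: product_prob_space "\<lambda>_. std_normal_distribution" I
    by (intro product_prob_spaceI P)
  have PN: "prob_space (?N i)" for i
    using P by (auto intro: prob_space.prob_space_distr)
  interpret N: product_prob_space ?N I
    by (intro product_prob_spaceI PN)
  have N_dens: "?N i = density std_normal_distribution (?w i)" for i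
    by (auto simp: distr_std_normal_scale[simplified] density_1)
  have sets_N: "sets (PiM I ?N) = sets (std_gaussian I)"
    by (intro sets_PiM_cong) auto
  have L: "?L = PiM I ?N"
  proof (rule N.PiM_eqI)
    fix A assume A: "\<And>i. i \<in> I \<Longrightarrow> A i \<in> sets (?N i)"
    then have A': "A i \<in> sets borel" if "i \<in> I" for i
      using that by (force split: if_splits)
    have PiE: "Pi\<^sub>E I A \<in> sets (std_gaussian I)"
      using A' by (auto intro!: sets_PiM_I_finite assms)
    define C where "C i = (if i \<in> J then (*) ?c -` A i else A i)" for i
    have C: "C i \<in> sets borel" if "i \<in> I" for i
      using A'[OF that] measurable_sets[of "(*) ?c" borel borel "A i"] by (simp add: C_def)
    have "scale_on J ?c -` Pi\<^sub>E I A \<inter> space (std_gaussian I) = Pi\<^sub>E I C"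
      using assms(2) by (fastforce simp: scale_on_def C_def space_PiM PiE_def Pi_def extensional_def)
    then have "?L (Pi\<^sub>E I A) = std_gaussian I (Pi\<^sub>E I C)"
      by (simp add: emeasure_distr measurable_scale_on assms PiE)
    also have "\<dots> = (\<Prod>i\<in>I. emeasure std_normal_distribution (C i))"
      using C by (intro G.emeasure_PiM assms) auto
    also have "\<dots> = (\<Prod>i\<in>I. emeasure (?N i) (A i))"
      using A' by (intro prod.cong) (auto simp: C_def emeasure_distr)
    finally show "?L (Pi\<^sub>E I A) = (\<Prod>i\<in>I. emeasure (?N i) (A i))" .
  qed (use assms sets_N in auto)
  have R: "?R = PiM I ?N"
  proof (rule N.PiM_eqI)
    fix A assume A: "\<And>i. i \<in> I \<Longrightarrow> A i \<in> sets (?N i)"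
    then have A'[measurable]: "i \<in> I \<Longrightarrow> A i \<in> sets borel" for i
      by (force split: if_splits)
    have PiE: "Pi\<^sub>E I A \<in> sets (std_gaussian I)"
      using A' by (auto intro!: sets_PiM_I_finite assms)
    have W: "ennreal (exp (\<Sum>j\<in>J. (u - (exp u - 1) * (x j)\<^sup>2) / 2)) = (\<Prod>i\<in>I. ?w i (x i))" for x
    proof -
      have fJ: "finite J" using assms finite_subset by blast
      have "ennreal (exp (\<Sum>j\<in>J. (u - (exp u - 1) * (x j)\<^sup>2) / 2)) = (\<Prod>i\<in>J. ?w i (x i))"
        using fJ by (simp add: exp_sum prod_ennreal)
      also have "\<dots> = (\<Prod>i\<in>I. ?w i (x i))"
        using assms by (intro prod.mono_neutral_left) auto
      finally show ?thesis .
    qed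
    have meas: "(\<lambda>x. \<Prod>i\<in>I. ?w i (x i)) \<in> borel_measurable (std_gaussian I)"
    proof (rule borel_measurable_prod_ennreal)
      fix i assume "i \<in> I"
      have "?w i \<in> borel_measurable std_normal_distribution" by (cases "i \<in> J") auto
      from measurable_compose[OF measurable_component_singleton[OF \<open>i \<in> I\<close>, of "\<lambda>_. std_normal_distribution"] this]
      show "(\<lambda>x. ?w i (x i)) \<in> borel_measurable (std_gaussian I)" .
    qed
    have "?R (Pi\<^sub>E I A) = (\<integral>\<^sup>+x. (\<Prod>i\<in>I. ?w i (x i)) * indicator (Pi\<^sub>E I A) x \<partial>std_gaussian I)"
      unfolding W by (rule emeasure_density[OF meas PiE])
    also have "\<dots> = (\<integral>\<^sup>+x. (\<Prod>i\<in>I. ?w i (x i) * indicator (A i) (x i)) \<partial>std_gaussian I)"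
    proof (rule nn_integral_cong)
      fix x assume "x \<in> space (std_gaussian I)"
      then have "indicator (Pi\<^sub>E I A) x = (\<Prod>i\<in>I. indicator (A i) (x i) :: ennreal)"
        using assms(1) by (auto simp: indicator_def space_PiM PiE_def Pi_def intro!: prod.neutral[symmetric])
      then show "(\<Prod>i\<in>I. ?w i (x i)) * indicator (Pi\<^sub>E I A) x = (\<Prod>i\<in>I. ?w i (x i) * indicator (A i) (x i))"
        by (simp add: prod.distrib)
    qed
    also have "\<dots> = (\<Prod>i\<in>I. \<integral>\<^sup>+y. ?w i y * indicator (A i) y \<partial>std_normal_distribution)"
      by (intro G.product_nn_integral_prod assms) auto
    also have "\<dots> = (\<Prod>i\<in>I. emeasure (?N i) (A i))"
    proof (rule prod.cong)
      fix i assume "i \<in> I"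
      then show "(\<integral>\<^sup>+y. ?w i y * indicator (A i) y \<partial>std_normal_distribution) = emeasure (?N i) (A i)"
        unfolding N_dens by (subst emeasure_density) auto
    qed simp
    finally show "?R (Pi\<^sub>E I A) = (\<Prod>i\<in>I. emeasure (?N i) (A i))" .
  qed (use assms sets_N in auto)
  show ?thesis using L R by simp
qed

section \<open>Anticoncentration of homogeneous functions\<close>

lemma prob_space_std_gaussian: "prob_space (std_gaussian I)"
  by (intro prob_space_PiM prob_space_normal_density) simp

text \<open>
  The dilations by \<open>e\<^sup>u\<^sup>/\<^sup>2\<close> with \<open>u = s k h\<close> and \<open>k < K\<close> carry the slab \<open>a \<le> f < a e\<^sup>h\<close> to \<open>K\<close>
  disjoint slabs. The density bound on \<open>E\<close> makes each of them at least \<open>e\<^sup>-\<^sup>1\<^sup>/\<^sup>2\<close> times as likely as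
  \<open>E\<close>, and their probabilities add up to at most 1. The sign \<open>s\<close> decides whether the slabs are
  moved outwards or inwards.
\<close>

lemma interval_prob_le_of_density_bound:
  fixes f :: "('i \<Rightarrow> real) \<Rightarrow> real" and s :: int
  assumes I: "finite I" "J \<subseteq> I"
    and f[measurable]: "f \<in> borel_measurable (std_gaussian I)"
    and hom: "\<And>u x. x \<in> space (std_gaussian I) \<Longrightarrow> f (scale_on J (exp (- u / 2)) x) = exp (- u) * f x"
    and K: "K > 0" and h: "h > 0" and a: "a > 0" and s: "s = 1 \<or> s = - 1"
    and E[measurable]: "E \<in> sets (std_gaussian I)"
    and slab: "\<And>x. x \<in> E \<Longrightarrow> a \<le> f x \<and> f x < a * exp h"
    and dens: "\<And>(u::real) x. x \<in> E \<Longrightarrow> 0 \<le> u \<Longrightarrow> u \<le> real K * h \<Longrightarrow>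
      exp (- 1 / 2) \<le> exp (\<Sum>j\<in>J. (of_int s * u - (exp (of_int s * u) - 1) * (x j)\<^sup>2) / 2)"
  shows "measure (std_gaussian I) E \<le> exp (1 / 2) / K"
proof -
  let ?P = "std_gaussian I"
  interpret P: prob_space ?P by (rule prob_space_std_gaussian)
  define A where "A k = {x \<in> space ?P. a * exp (real_of_int k * h) \<le> f x \<and>
      f x < a * exp (real_of_int (k + 1) * h)}" for k :: int
  have A_sets[measurable]: "A k \<in> sets ?P" for k unfolding A_def by measurable
  have A_disj: "A k \<inter> A l = {}" if "k < l" for k l
  proof -
    have "real_of_int (k + 1) * h \<le> real_of_int l * h"
      using that h by (intro mult_right_mono) auto
    then have "a * exp (real_of_int (k + 1) * h) \<le> a * exp (real_of_int l * h)"
      using a by simp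
    then show ?thesis by (fastforce simp: A_def)
  qed
  have disj: "disjoint_family_on (\<lambda>k. A (s * int k)) {..<K}"
    unfolding disjoint_family_on_def
  proof safe
    fix k l x assume "k \<noteq> l" and x: "x \<in> A (s * int k)" "x \<in> A (s * int l)"
    then have "s * int k < s * int l \<or> s * int l < s * int k" using s by auto
    then show "x \<in> {}" using A_disj x by blast
  qed
  have each: "exp (- 1 / 2) * P.prob E \<le> P.prob (A (s * int k))" if k: "k < K" for k
  proof -
    define u where "u = real_of_int s * (real k * h)"
    let ?w = "\<lambda>x. exp (\<Sum>j\<in>J. (u - (exp u - 1) * (x j)\<^sup>2) / 2)"
    let ?T = "scale_on J (exp (- u / 2))"
    have T[measurable]: "?T \<in> measurable ?P ?P" by (rule measurable_scale_on[OF I(2)])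
    have w[measurable]: "?w \<in> borel_measurable ?P"
    proof -
      have "(\<lambda>x. x j) \<in> borel_measurable ?P" if "j \<in> J" for j
        using measurable_component_singleton[of j I "\<lambda>_. std_normal_distribution"] that I(2) by auto
      then show ?thesis by measurable
    qed
    have "A (s * int k) = ?T -` A 0 \<inter> space ?P"
    proof -
      have "x \<in> A (s * int k) \<longleftrightarrow> ?T x \<in> A 0" if x: "x \<in> space ?P" for x
      proof -
        have "exp (- u) * f x < a * exp h \<longleftrightarrow> f x < a * exp (u + h)"
          "a \<le> exp (- u) * f x \<longleftrightarrow> a * exp u \<le> f x"
          by (auto simp: exp_minus exp_add field_simps)
        moreover have "?T x \<in> space ?P" using measurable_space[OF T x] .
        ultimately show ?thesis
          unfolding A_def by (auto simp only: mem_Collect_eq hom[OF x] u_def x)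
             (simp_all add: algebra_simps)
      qed
      then show ?thesis by (auto simp: A_def)
    qed
    then have "emeasure ?P (A (s * int k)) = emeasure (distr ?P ?P ?T) (A 0)"
      by (subst emeasure_distr[OF T A_sets]) simp
    also have "\<dots> = (\<integral>\<^sup>+x. ennreal (?w x) * indicator (A 0) x \<partial>?P)"
      unfolding distr_std_gaussian_scale[OF I] by (rule emeasure_density) measurable
    also have "\<dots> \<ge> (\<integral>\<^sup>+x. ennreal (exp (- 1 / 2)) * indicator E x \<partial>?P)"
    proof (rule nn_integral_mono)
      fix x assume x: "x \<in> space ?P"
      show "ennreal (exp (- 1 / 2)) * indicator E x \<le> ennreal (?w x) * indicator (A 0) x"
      proof (cases "x \<in> E")
        case True
        then have "x \<in> A 0" using slab[of x] x by (auto simp: A_def)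
        moreover have "exp (- 1 / 2) \<le> ?w x"
          unfolding u_def using h k by (intro dens[OF True]) auto
        ultimately show ?thesis using True by (simp add: ennreal_leI)
      qed simp
    qed
    also (xtrans) have "(\<integral>\<^sup>+x. ennreal (exp (- 1 / 2)) * indicator E x \<partial>?P) = ennreal (exp (- 1 / 2) * P.prob E)"
      by (simp add: nn_integral_cmult_indicator P.emeasure_eq_measure ennreal_mult)
    finally show ?thesis by (simp add: P.emeasure_eq_measure)
  qed
  have "real K * (exp (- 1 / 2) * P.prob E) \<le> (\<Sum>k<K. P.prob (A (s * int k)))"
    using each sum_mono[of "{..<K}" "\<lambda>_. exp (- 1 / 2) * P.prob E"] by simp
  also have "\<dots> = P.prob (\<Union>k<K. A (s * int k))"
    by (rule P.finite_measure_finite_Union[symmetric]) (use disj in auto)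
  also have "\<dots> \<le> 1" by simp
  finally have "real K * P.prob E \<le> exp (1 / 2)"
    by (simp add: exp_minus field_simps)
  then show ?thesis using K by (simp add: field_simps)
qed

text \<open>
  The dilation density is monotone in the squared norm of the coordinates in \<open>J\<close>, and equals
  \<open>exp (- m (e\<^sup>v - 1 - v) / 2)\<close> when that squared norm is its mean \<open>m\<close>, the cardinality of \<open>J\<close>. So below
  the mean outward dilations have density at least this value, and above the mean inward ones do.
  As \<open>e\<^sup>v - 1 - v \<le> v\<^sup>2\<close> for \<open>\<bar>v\<bar> \<le> 1\<close>, the value is bounded below for \<open>\<bar>v\<bar> \<le> m\<^sup>-\<^sup>1\<^sup>/\<^sup>2\<close>.
\<close>

lemma interval_prob_le:
  fixes f :: "('i \<Rightarrow> real) \<Rightarrow> real"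
  assumes I: "finite I" "J \<subseteq> I" and J: "J \<noteq> {}"
    and f[measurable]: "f \<in> borel_measurable (std_gaussian I)"
    and hom: "\<And>c x. c > 0 \<Longrightarrow> x \<in> space (std_gaussian I) \<Longrightarrow> f (scale_on J c x) = c\<^sup>2 * f x"
    and K: "K > 0" and a: "a > 0"
  shows "measure (std_gaussian I) {x \<in> space (std_gaussian I). a \<le> f x \<and>
      f x < a * exp (1 / (real K * sqrt (card J)))} \<le> 2 * exp (1 / 2) / K"
proof -
  let ?P = "std_gaussian I" and ?m = "real (card J)"
  interpret P: prob_space ?P by (rule prob_space_std_gaussian)
  define h where "h = 1 / (real K * sqrt ?m)"
  have m: "?m \<ge> 1" using J I finite_subset[OF I(2,1)] by (simp add: Suc_le_eq card_gt_0_iff)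
  then have sm: "sqrt ?m \<ge> 1" by simp
  have h: "h > 0" using K sm by (simp add: h_def)
  define q where "q x = (\<Sum>j\<in>J. (x j)\<^sup>2)" for x :: "'i \<Rightarrow> real"
  have q[measurable]: "q \<in> borel_measurable ?P"
  proof -
    have "(\<lambda>x. x j) \<in> borel_measurable ?P" if "j \<in> J" for j
      using measurable_component_singleton[of j I "\<lambda>_. std_normal_distribution"] that I(2) by auto
    then show ?thesis unfolding q_def by measurable
  qed
  have hom': "f (scale_on J (exp (- u / 2)) x) = exp (- u) * f x" if "x \<in> space ?P" for u x
  proof -
    have "(exp (- u / 2))\<^sup>2 = exp (- u)" by (simp add: power2_eq_square flip: exp_add)
    then show ?thesis using hom[OF _ that, of "exp (- u / 2)"] by simp
  qed
  have w: "(\<Sum>j\<in>J. (u - (exp u - 1) * (x j)\<^sup>2) / 2) = (?m * u - (exp u - 1) * q x) / 2" for u x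
    by (simp add: q_def sum_subtractf sum_distrib_left flip: sum_divide_distrib)
  have quad: "?m * (exp v - 1 - v) \<le> 1" if "\<bar>v\<bar> \<le> 1 / sqrt ?m" for v
  proof -
    have v1: "\<bar>v\<bar> \<le> 1" using that sm by (meson divide_le_eq_1_pos dual_order.trans zero_less_one less_le_trans)
    have "exp v \<le> 1 + v + v\<^sup>2"
    proof (cases "v \<ge> 0")
      case True then show ?thesis using exp_bound[of v] v1 by simp
    next
      case False
      have "1 \<le> (1 + v + v\<^sup>2) * (1 - v)"
        using False by (simp add: power2_eq_square algebra_simps mult_nonpos_nonneg)
      also have "\<dots> \<le> (1 + v + v\<^sup>2) * exp (- v)"
        using exp_ge_add_one_self[of "- v"] v1 by (intro mult_left_mono) auto
      finally show ?thesis by (simp add: exp_minus field_simps)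
    qed
    then have "?m * (exp v - 1 - v) \<le> ?m * v\<^sup>2" by (intro mult_left_mono) auto
    also have "v\<^sup>2 \<le> (1 / sqrt ?m)\<^sup>2" using that by (metis abs_ge_zero power2_abs power_mono)
    then have "?m * v\<^sup>2 \<le> 1" using m by (simp add: power_divide field_simps)
    finally show ?thesis .
  qed
  have Kh: "real K * h = 1 / sqrt ?m" using K by (simp add: h_def)
  define E where "E = {x \<in> space ?P. a \<le> f x \<and> f x < a * exp h}"
  have E[measurable]: "E \<in> sets ?P" unfolding E_def by measurable
  have lo: "P.prob {x \<in> E. q x \<le> ?m} \<le> exp (1 / 2) / K"
  proof (rule interval_prob_le_of_density_bound[OF I f hom' K h a, of 1])
    have "{x \<in> E. q x \<le> ?m} = E \<inter> {x \<in> space ?P. q x \<le> ?m}" by (auto simp: E_def)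
    then show "{x \<in> E. q x \<le> ?m} \<in> sets ?P" by simp
    fix u :: real and x assume x: "x \<in> {x \<in> E. q x \<le> ?m}" and u: "0 \<le> u" "u \<le> real K * h"
    have "(exp u - 1) * q x \<le> (exp u - 1) * ?m"
      using x u by (intro mult_left_mono) auto
    then show "exp (- 1 / 2) \<le> exp (\<Sum>j\<in>J. (of_int 1 * u - (exp (of_int 1 * u) - 1) * (x j)\<^sup>2) / 2)"
      using quad[of u] u Kh unfolding of_int_1 mult_1_left w by (simp add: algebra_simps)
  qed (auto simp: E_def)
  have hi: "P.prob {x \<in> E. q x > ?m} \<le> exp (1 / 2) / K"
  proof (rule interval_prob_le_of_density_bound[OF I f hom' K h a, of "- 1"])
    have "{x \<in> E. q x > ?m} = E \<inter> {x \<in> space ?P. q x > ?m}" by (auto simp: E_def)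
    then show "{x \<in> E. q x > ?m} \<in> sets ?P" by simp
    fix u :: real and x assume x: "x \<in> {x \<in> E. q x > ?m}" and u: "0 \<le> u" "u \<le> real K * h"
    have "(1 - exp (- u)) * q x \<ge> (1 - exp (- u)) * ?m"
      using x u by (intro mult_left_mono) auto
    then show "exp (- 1 / 2) \<le> exp (\<Sum>j\<in>J. (of_int (- 1) * u - (exp (of_int (- 1) * u) - 1) * (x j)\<^sup>2) / 2)"
      using quad[of "- u"] u Kh unfolding w by (simp add: algebra_simps)
  qed (auto simp: E_def)
  have sets: "{x \<in> E. q x \<le> ?m} \<in> sets ?P" "{x \<in> E. q x > ?m} \<in> sets ?P"
    unfolding E_def by measurable
  have "E = {x \<in> E. q x \<le> ?m} \<union> {x \<in> E. q x > ?m}" by auto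
  then have "P.prob E \<le> P.prob {x \<in> E. q x \<le> ?m} + P.prob {x \<in> E. q x > ?m}"
    using measure_Un_le[OF sets] by simp
  then show ?thesis using lo hi by (simp add: E_def h_def)
qed

section \<open>Second moments of sums over independent coordinates\<close>

text \<open>Independence and centering kill the mixed terms of the expanded square.\<close>

lemma (in product_prob_space) second_moment_sum_centered:
  fixes g :: "'a \<Rightarrow> real"
  assumes I: "finite I" "J \<subseteq> I"
    and int: "\<And>i. i \<in> J \<Longrightarrow> integrable (M i) g" "\<And>i. i \<in> J \<Longrightarrow> integrable (M i) (\<lambda>y. (g y)\<^sup>2)"
    and mean: "\<And>i. i \<in> J \<Longrightarrow> integral\<^sup>L (M i) g = 0"
  shows "integrable (PiM I M) (\<lambda>x. (\<Sum>i\<in>J. g (x i))\<^sup>2)" (is ?I)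
    and "(LINT x|PiM I M. (\<Sum>i\<in>J. g (x i))\<^sup>2) = (\<Sum>i\<in>J. LINT y|M i. (g y)\<^sup>2)" (is ?E)
proof -
  have fJ: "finite J" using I finite_subset by blast
  have pair: "integrable (PiM I M) (\<lambda>x. g (x i) * g (x j)) \<and>
      (LINT x|PiM I M. g (x i) * g (x j)) = (if i = j then LINT y|M i. (g y)\<^sup>2 else 0)"
    if ij: "i \<in> J" "j \<in> J" for i j
  proof -
    \<comment> \<open>The product of two coordinate functions as a full product over \<open>I\<close>; both factors fall on
        the same coordinate when \<open>i = j\<close>.\<close>
    define F where "F k = (\<lambda>y. (if k = i then g y else 1) * (if k = j then g y else 1))" for k
    have Fint: "integrable (M k) (F k)" for k
      using int ij by (cases "k = i"; cases "k = j") (auto simp: F_def power2_eq_square)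
    have P: "(\<Prod>k\<in>I. F k (x k)) = g (x i) * g (x j)" for x
      using I ij by (auto simp: F_def prod.distrib prod.delta)
    have "(\<Prod>k\<in>I. integral\<^sup>L (M k) (F k)) = (if i = j then LINT y|M i. (g y)\<^sup>2 else 0)"
    proof (cases "i = j")
      case True
      then have "integral\<^sup>L (M k) (F k) = (if k = i then LINT y|M i. (g y)\<^sup>2 else 1)" for k
        by (simp add: F_def power2_eq_square M.prob_space)
      then show ?thesis using True I ij by (simp add: prod.delta subset_eq)
    next
      case False
      then have "integral\<^sup>L (M i) (F i) = 0" using mean ij by (simp add: F_def)
      then show ?thesis using False I ij by (auto intro: prod_zero)
    qed
    then show ?thesis
      using product_integrable_prod[OF I(1) Fint] product_integral_prod[OF I(1) Fint] by (simp add: P)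
  qed
  have sq: "(\<Sum>i\<in>J. g (x i))\<^sup>2 = (\<Sum>i\<in>J. \<Sum>j\<in>J. g (x i) * g (x j))" for x
    by (simp add: power2_eq_square sum_product)
  show ?I unfolding sq using pair by (intro Bochner_Integration.integrable_sum) auto
  have "(LINT x|PiM I M. (\<Sum>i\<in>J. g (x i))\<^sup>2) = (\<Sum>i\<in>J. \<Sum>j\<in>J. if i = j then LINT y|M i. (g y)\<^sup>2 else 0)"
    unfolding sq using pair by (subst Bochner_Integration.integral_sum; auto simp: Bochner_Integration.integral_sum)+
  also have "\<dots> = (\<Sum>i\<in>J. LINT y|M i. (g y)\<^sup>2)"
    using fJ by (simp add: sum.delta)
  finally show ?E .
qed

lemma std_normal_centered_square:
  shows "integrable std_normal_distribution (\<lambda>y. y\<^sup>2 - 1)"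
    and "integrable std_normal_distribution (\<lambda>y. (y\<^sup>2 - 1)\<^sup>2)"
    and "(LINT y|std_normal_distribution. y\<^sup>2 - 1) = 0"
    and "(LINT y|std_normal_distribution. (y\<^sup>2 - 1)\<^sup>2) = 2"
proof -
  have "prob_space std_normal_distribution" by (rule prob_space_normal_density) simp
  then interpret prob_space std_normal_distribution .
  have i[simp]: "integrable std_normal_distribution (\<lambda>y. y ^ n)" for n
    by (rule integrable_std_normal_distribution_moment)
  have e2: "(LINT y|std_normal_distribution. y\<^sup>2) = 1"
    using std_normal_distribution_even_moments(1)[of 1] by simp
  have e4: "(LINT y|std_normal_distribution. y ^ 4) = 3"
    using std_normal_distribution_even_moments(1)[of 2] by (simp add: fact_numeral)
  have sq: "(y\<^sup>2 - 1)\<^sup>2 = y ^ 4 - 2 * y\<^sup>2 + 1" for y :: real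
    by (simp add: power2_eq_square power4_eq_xxxx algebra_simps)
  have p: "measure std_normal_distribution UNIV = 1" using prob_space by simp
  show "integrable std_normal_distribution (\<lambda>y. y\<^sup>2 - 1)"
    "integrable std_normal_distribution (\<lambda>y. (y\<^sup>2 - 1)\<^sup>2)"
    unfolding sq by auto
  show "(LINT y|std_normal_distribution. y\<^sup>2 - 1) = 0"
    by (simp add: e2 p)
  show "(LINT y|std_normal_distribution. (y\<^sup>2 - 1)\<^sup>2) = 2"
    unfolding sq by (simp add: e2 e4 p)
qed

section \<open>The longest row statistic under the two laws\<close>

lemma kappa_r_schur:
  assumes "pair_graph G"
  shows "kappa_r G v (schur (pverts G) (adj_matrix G) M) = 1 / real (maxdeg G) * (\<Sum>i\<in>neighbors G v. (M (v, i))\<^sup>2)"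
proof -
  interpret pair_graph G by fact
  have "schur (pverts G) (adj_matrix G) M (v, i) = M (v, i)" if "i \<in> neighbors G v" for i
    using that by (auto simp: neighbors_def schur_def adj_matrix_def dest: in_arcsD1 in_arcsD2)
  then show ?thesis by (simp add: kappa_r_def)
qed

text \<open>
  The chosen vertex is not its own neighbour, so every entry that enters the statistic is an
  off-diagonal inner product, linear in the column of \<open>v\<close>.
\<close>

lemma kappa_r_wishart_interval:
  fixes G :: "nat pair_pre_digraph"
  assumes G: "pair_graph G" and v: "v \<in> pverts G" and d: "d > 0" and K: "K > 0" and a: "a > 0"
  shows "measure (kappa_r_law G v (masked_wishart G d)) {a ..< a * exp (1 / (real K * sqrt d))}
    \<le> 2 * exp (1 / 2) / K"
proof -
  interpret pair_graph G by fact
  let ?V = "pverts G"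
  let ?I = "{1..d} \<times> ?V"
  let ?J = "{1..d} \<times> {v}"
  let ?M = "\<lambda>X. schur ?V (adj_matrix G) (normalized_gram d ?V X)"
  define f where "f X = kappa_r G v (?M X)" for X
  have M: "?M \<in> measurable (gaussian_matrix d ?V) (matrix_space ?V)" by measurable
  have f[measurable]: "f \<in> borel_measurable (gaussian_matrix d ?V)"
    unfolding f_def by (rule measurable_compose[OF M measurable_kappa_r[OF G v]])
  have hom: "f (scale_on ?J c X) = c\<^sup>2 * f X" for c X
  proof -
    have "normalized_gram d ?V (scale_on ?J c X) (v, i) = c * normalized_gram d ?V X (v, i)"
      if i: "i \<in> neighbors G v" for i
    proof -
      have "i \<in> ?V" "i \<noteq> v"
        using i by (auto simp: neighbors_def dest: in_arcsD2 pair_no_loops)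
      then show ?thesis
        using v by (simp add: normalized_gram_def scale_on_def sum_distrib_left mult.assoc)
    qed
    then show ?thesis
      by (simp add: f_def kappa_r_schur[OF G] power_mult_distrib sum_distrib_left mult_ac)
  qed
  have "measure (std_gaussian ?I) {x \<in> space (std_gaussian ?I). a \<le> f x \<and>
      f x < a * exp (1 / (real K * sqrt (card ?J)))} \<le> 2 * exp (1 / 2) / K"
    using f hom K a d v pair_finite_verts by (intro interval_prob_le) (auto simp: gaussian_matrix_def)
  moreover have "measure (kappa_r_law G v (masked_wishart G d)) {a ..< a * exp (1 / (real K * sqrt d))} =
      measure (gaussian_matrix d ?V) {x \<in> space (gaussian_matrix d ?V). a \<le> f x \<and>
        f x < a * exp (1 / (real K * sqrt d))}"
  proof -
    have eq: "kappa_r_law G v (masked_wishart G d) = distr (gaussian_matrix d ?V) borel f"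
      unfolding kappa_r_law_def masked_wishart_def
      using distr_distr[OF measurable_kappa_r[OF G v] M] by (simp add: f_def[abs_def] comp_def)
    show ?thesis
      unfolding eq by (subst measure_distr[OF f]) (auto intro!: arg_cong[where f = "measure _"])
  qed
  ultimately show ?thesis by (simp add: gaussian_matrix_def)
qed

text \<open>
  The entries that enter the statistic sit at distinct positions strictly above the diagonal, after
  reflection of those below it, so their squares are independent with mean 1 and variance 2. The
  statistic then has variance \<open>2 / \<Delta>\<close>, and the bound is Chebyshev's inequality.
\<close>

lemma kappa_r_goe_concentration:
  fixes G :: "nat pair_pre_digraph"
  assumes G: "pair_graph G" and v: "max_degree_vertex G v" and deg: "maxdeg G > 0" and t: "t > 0"
  shows "measure (kappa_r_law G v (masked_goe G)) {x. \<bar>x - 1\<bar> \<ge> t} \<le> 2 / (real (maxdeg G) * t\<^sup>2)"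
proof -
  interpret pair_graph G by fact
  let ?V = "pverts G" and ?N = "neighbors G v" and ?m = "real (maxdeg G)"
  let ?D = "\<lambda>p :: nat \<times> nat. density lborel (normal_density 0 (if fst p = snd p then sqrt 2 else 1))"
  let ?U = "{(i, j) \<in> ?V \<times> ?V. i \<le> j}"
  let ?e = "\<lambda>i. (min v i, max v i)"
  have vV: "v \<in> ?V" and card: "card ?N = maxdeg G" using v by (auto simp: max_degree_vertex_def)
  have N: "i \<in> ?V" "i \<noteq> v" if "i \<in> ?N" for i
    using that by (auto simp: neighbors_def dest: in_arcsD2 pair_no_loops)
  have PD: "prob_space (?D p)" for p by (rule prob_space_normal_density) simp
  interpret D: product_prob_space ?D ?U by (intro product_prob_spaceI PD)
  have Q_eq: "goe_upper ?V = PiM ?U ?D" by (simp add: goe_upper_def)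
  interpret Q: prob_space "goe_upper ?V" unfolding Q_eq by (intro prob_space_PiM PD)
  define f where "f Z = kappa_r G v (schur ?V (adj_matrix G) (symmetrize ?V Z))" for Z
  let ?M = "\<lambda>Z. schur ?V (adj_matrix G) (symmetrize ?V Z)"
  have M: "?M \<in> measurable (goe_upper ?V) (matrix_space ?V)" by measurable
  have f[measurable]: "f \<in> borel_measurable (goe_upper ?V)"
    unfolding f_def by (rule measurable_compose[OF M measurable_kappa_r[OF G vV]])
  have law: "kappa_r_law G v (masked_goe G) = distr (goe_upper ?V) borel f"
  proof -
    have "masked_goe G = distr (goe_upper ?V) (matrix_space ?V) ?M"
      unfolding masked_goe_def GOE_def
      by (subst distr_distr[OF measurable_schur measurable_symmetrize]) (simp add: comp_def)
    then show ?thesis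
      unfolding kappa_r_law_def
      using distr_distr[OF measurable_kappa_r[OF G vV] M] by (simp add: f_def[abs_def] comp_def)
  qed
  have inj: "inj_on ?e ?N"
    by (auto simp: inj_on_def min_def max_def split: if_splits)
  let ?J = "?e ` ?N"
  have U: "finite ?U" "?J \<subseteq> ?U"
    using pair_finite_verts vV N by (auto simp: min_def max_def intro: finite_subset[of _ "?V \<times> ?V"])
  have f_eq: "f Z - 1 = (\<Sum>p\<in>?J. (Z p)\<^sup>2 - 1) / ?m" for Z
  proof -
    have "f Z = (\<Sum>i\<in>?N. (Z (?e i))\<^sup>2) / ?m"
      using N vV by (simp add: f_def kappa_r_schur[OF G] symmetrize_def)
    also have "\<dots> = (\<Sum>p\<in>?J. (Z p)\<^sup>2) / ?m"
      by (simp add: sum.reindex[OF inj])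
    finally show ?thesis
      using deg by (simp add: sum_subtractf card_image[OF inj] card field_simps)
  qed
  have DJ: "?D p = std_normal_distribution" if "p \<in> ?J" for p
    using that N by (force simp: min_def max_def)
  have moments: "integrable (PiM ?U ?D) (\<lambda>Z. (\<Sum>p\<in>?J. (Z p)\<^sup>2 - 1)\<^sup>2)"
      "(LINT Z|PiM ?U ?D. (\<Sum>p\<in>?J. (Z p)\<^sup>2 - 1)\<^sup>2) = (\<Sum>p\<in>?J. LINT y|?D p. (y\<^sup>2 - 1)\<^sup>2)"
    using D.second_moment_sum_centered[OF U, of "\<lambda>y. y\<^sup>2 - 1"]
    by (simp_all only: DJ std_normal_centered_square)
  have "(\<Sum>p\<in>?J. LINT y|?D p. (y\<^sup>2 - 1)\<^sup>2) = (\<Sum>p\<in>?J. 2)"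
    by (rule sum.cong) (simp_all only: DJ std_normal_centered_square)
  then have mom: "(LINT Z|goe_upper ?V. (f Z - 1)\<^sup>2) = 2 / ?m"
    using moments deg by (simp add: f_eq power_divide Q_eq card_image[OF inj] card power2_eq_square)
  have int: "integrable (goe_upper ?V) (\<lambda>Z. (f Z - 1)\<^sup>2)"
    using moments(1) by (simp add: f_eq power_divide Q_eq)
  have "measure (kappa_r_law G v (masked_goe G)) {x. \<bar>x - 1\<bar> \<ge> t} =
      Q.prob {Z \<in> space (goe_upper ?V). (f Z - 1)\<^sup>2 \<ge> t\<^sup>2}"
    unfolding law using t
    by (subst measure_distr[OF f]) (auto intro!: arg_cong[where f = Q.prob] simp: abs_le_square_iff[symmetric])
  also have "\<dots> \<le> (LINT Z|goe_upper ?V. (f Z - 1)\<^sup>2) / t\<^sup>2"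
    by (rule integral_Markov_inequality_measure[OF int, where A = "{}"]) (use t in auto)
  finally show ?thesis by (simp add: mom)
qed

section \<open>Total variation distance\<close>

lemma abs_measure_diff_le_1:
  assumes "prob_space M" "prob_space N"
  shows "\<bar>measure M A - measure N A\<bar> \<le> 1"
  using prob_space.prob_le_1[OF assms(1), of A] prob_space.prob_le_1[OF assms(2), of A]
    measure_nonneg[of M A] measure_nonneg[of N A] by linarith

lemma total_variation_le_1:
  assumes "prob_space M" "prob_space N"
  shows "total_variation M N \<le> 1"
  unfolding total_variation_def
  by (rule cSUP_least) (use abs_measure_diff_le_1[OF assms] sets.empty_sets in blast)+

lemma abs_measure_diff_le_total_variation:
  assumes "prob_space M" "prob_space N" "A \<in> sets M"
  shows "\<bar>measure M A - measure N A\<bar> \<le> total_variation M N"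
  unfolding total_variation_def
proof (rule cSUP_upper[OF assms(3)])
  show "bdd_above ((\<lambda>A. \<bar>measure M A - measure N A\<bar>) ` sets M)"
    using abs_measure_diff_le_1[OF assms(1,2)] by (auto simp: bdd_above_def)
qed

text \<open>Every event for the image measures is an event for the original ones.\<close>

lemma total_variation_distr_le:
  assumes "prob_space M" "prob_space N" and sets: "sets N = sets M" and f: "f \<in> measurable M L"
  shows "total_variation (distr M L f) (distr N L f) \<le> total_variation M N"
  unfolding total_variation_def[of "distr M L f"]
proof (rule cSUP_least)
  have fN: "f \<in> measurable N L" using f sets measurable_cong_sets by blast
  have sp: "space N = space M" using sets by (rule sets_eq_imp_space_eq)
  fix A assume A: "A \<in> sets (distr M L f)"
  then have "f -` A \<inter> space M \<in> sets M" using f by (auto intro: measurable_sets)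
  from abs_measure_diff_le_total_variation[OF assms(1,2) this]
  show "\<bar>measure (distr M L f) A - measure (distr N L f) A\<bar> \<le> total_variation M N"
    using A by (simp add: measure_distr[OF f] measure_distr[OF fN] sp)
qed (use sets.empty_sets in blast)

section \<open>Separation of the two laws\<close>

text \<open>
  The test event is \<open>[e\<^sup>-\<^sup>h\<^sup>/\<^sup>2, e\<^sup>h\<^sup>/\<^sup>2)\<close> with \<open>h = 1 / (K \<surd>d)\<close>. It contains the points at distance less
  than \<open>h / 4\<close> from 1, so the GOE law misses it with probability at most \<open>2 / (\<Delta> (h / 4)\<^sup>2)\<close>.
\<close>

lemma total_variation_kappa_r_ge:
  fixes G :: "nat pair_pre_digraph"
  assumes G: "pair_graph G" and v: "max_degree_vertex G v" and deg: "maxdeg G > 0" and d: "d > 0" and K: "K > 0"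
  shows "1 - 2 * exp (1 / 2) / K - 32 * (real K)\<^sup>2 * (real d / real (maxdeg G)) \<le>
    total_variation (kappa_r_law G v (masked_wishart G d)) (kappa_r_law G v (masked_goe G))"
proof -
  let ?W = "kappa_r_law G v (masked_wishart G d)" and ?M = "kappa_r_law G v (masked_goe G)"
  have vV: "v \<in> pverts G" using v by (simp add: max_degree_vertex_def)
  have sW: "sets (masked_wishart G d) = sets (matrix_space (pverts G))" and sM: "sets (masked_goe G) = sets (matrix_space (pverts G))"
    by (simp_all add: masked_wishart_def masked_goe_def)
  have PW: "prob_space ?W" unfolding kappa_r_law_def
    using measurable_kappa_r[OF G vV] measurable_cong_sets[OF sW refl]
    by (intro prob_space.prob_space_distr prob_space_masked_wishart) auto
  have PM: "prob_space ?M" unfolding kappa_r_law_def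
    using measurable_kappa_r[OF G vV] measurable_cong_sets[OF sM refl]
    by (intro prob_space.prob_space_distr prob_space_masked_goe) auto
  interpret M: prob_space ?M by fact
  define h where "h = 1 / (real K * sqrt d)"
  define B where "B = {exp (- h / 2) ..< exp (- h / 2) * exp h}"
  have "real K * sqrt d \<ge> 1"
    using mult_mono[of 1 "real K" 1 "sqrt d"] K d by simp
  then have h: "0 < h" "h \<le> 1" by (auto simp: h_def intro: order.strict_trans2)
  have W: "measure ?W B \<le> 2 * exp (1 / 2) / K"
    unfolding B_def h_def by (rule kappa_r_wishart_interval[OF G vV d K]) simp
  have "B \<supseteq> {x. \<bar>x - 1\<bar> < h / 4}"
  proof
    fix x assume x: "x \<in> {x. \<bar>x - 1\<bar> < h / 4}"
    have up: "exp (- h / 2) * exp h \<ge> 1 + h / 2"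
      using exp_ge_add_one_self[of "h / 2"] by (simp flip: exp_add)
    have "1 \<le> (1 - h / 4) * (1 + h / 2)" using h by (simp add: algebra_simps mult_le_one)
    also have "\<dots> \<le> (1 - h / 4) * exp (h / 2)"
      using exp_ge_add_one_self[of "h / 2"] h by (intro mult_left_mono) auto
    finally have "exp (- h / 2) \<le> 1 - h / 4" by (simp add: exp_minus field_simps)
    then show "x \<in> B" using x up h by (auto simp: B_def abs_if split: if_splits)
  qed
  then have "UNIV - B \<subseteq> {x. \<bar>x - 1\<bar> \<ge> h / 4}" by (auto simp: not_less[symmetric])
  then have "M.prob (UNIV - B) \<le> M.prob {x. \<bar>x - 1\<bar> \<ge> h / 4}"
    by (intro M.finite_measure_mono) (auto simp: kappa_r_law_def)
  also have "\<dots> \<le> 2 / (real (maxdeg G) * (h / 4)\<^sup>2)"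
    using h by (intro kappa_r_goe_concentration[OF G v deg]) simp
  also have "\<dots> = 32 * (real K)\<^sup>2 * (real d / real (maxdeg G))"
    using K d by (simp add: h_def power_divide power_mult_distrib field_simps)
  finally have "1 - M.prob B \<le> 32 * (real K)\<^sup>2 * (real d / real (maxdeg G))"
    using M.prob_compl[of B] by (simp add: kappa_r_law_def B_def)
  moreover have "\<bar>measure ?W B - M.prob B\<bar> \<le> total_variation ?W ?M"
    by (rule abs_measure_diff_le_total_variation[OF PW PM]) (simp add: kappa_r_law_def B_def)
  ultimately show ?thesis using W by linarith
qed

text \<open>For fixed \<open>K\<close> the last error term vanishes in the limit; what is left is small for large \<open>K\<close>.\<close>

lemma tendsto_1_of_two_scale_bounds:
  fixes T :: "nat \<Rightarrow> real" and r :: "nat \<Rightarrow> real"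
  assumes r: "r \<longlonglongrightarrow> 0"
    and lower: "\<And>K :: nat. K > 0 \<Longrightarrow> \<forall>\<^sub>F n in sequentially. 1 - A / K - C * (real K)\<^sup>2 * r n \<le> T n"
    and upper: "\<forall>\<^sub>F n in sequentially. T n \<le> 1"
  shows "T \<longlonglongrightarrow> 1"
proof (rule order_tendstoI)
  fix b :: real assume "b < 1"
  have "(\<lambda>K. 1 - A / real (Suc K)) \<longlonglongrightarrow> 1 - 0"
    by (intro tendsto_diff tendsto_const LIMSEQ_Suc[OF lim_const_over_n])
  with \<open>b < 1\<close> have "\<forall>\<^sub>F K in sequentially. b < 1 - A / real (Suc K)"
    by (auto dest: order_tendstoD(1))
  then obtain K where K: "b < 1 - A / real (Suc K)"
    by (auto simp: eventually_sequentially)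
  have "(\<lambda>n. 1 - A / Suc K - C * (real (Suc K))\<^sup>2 * r n) \<longlonglongrightarrow> 1 - A / Suc K - C * (real (Suc K))\<^sup>2 * 0"
    by (intro tendsto_intros r)
  with K have "\<forall>\<^sub>F n in sequentially. b < 1 - A / Suc K - C * (real (Suc K))\<^sup>2 * r n"
    by (auto dest: order_tendstoD(1))
  with lower[of "Suc K"] show "\<forall>\<^sub>F n in sequentially. b < T n"
    by (auto elim: eventually_elim2)
next
  fix b :: real assume "1 < b"
  with upper show "\<forall>\<^sub>F n in sequentially. T n < b" by (auto elim: eventually_mono)
qed

theorem theorem3p3:
  fixes G :: "nat \<Rightarrow> nat pair_pre_digraph" and d :: "nat \<Rightarrow> nat"
  assumes simple_graph: "\<And>n. n \<ge> 1 \<Longrightarrow> pair_graph (G n)"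
    and vertices: "\<And>n. n \<ge> 1 \<Longrightarrow> pverts (G n) = {1..n}"
    and d_pos: "\<And>n. n \<ge> 1 \<Longrightarrow> d n > 0"
    and d_small: "filterlim (\<lambda>n. real (maxdeg (G n)) / real (d n)) at_top sequentially"
  shows "(\<forall>vstar :: nat \<Rightarrow> nat. (\<forall>n\<ge>1. max_degree_vertex (G n) (vstar n)) \<longrightarrow>
           (\<lambda>n. total_variation
                  (kappa_r_law (G n) (vstar n) (masked_wishart (G n) (d n)))
                  (kappa_r_law (G n) (vstar n) (masked_goe (G n)))) \<longlonglongrightarrow> 1)
       \<and> (\<lambda>n. total_variation (masked_wishart (G n) (d n)) (masked_goe (G n))) \<longlonglongrightarrow> 1"
proof -
  define r where "r n = real (d n) / real (maxdeg (G n))" for n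
  have r: "r \<longlonglongrightarrow> 0"
    using tendsto_inverse_0_at_top[OF d_small] by (simp add: r_def[abs_def] inverse_eq_divide)
  have "\<forall>\<^sub>F n in sequentially. 1 \<le> real (maxdeg (G n)) / real (d n)"
    using d_small by (simp add: filterlim_at_top)
  then have deg: "\<forall>\<^sub>F n in sequentially. maxdeg (G n) > 0"
    by (rule eventually_mono) (auto intro: Nat.gr0I)
  have ge1: "\<forall>\<^sub>F n :: nat in sequentially. n \<ge> 1" by (rule eventually_ge_at_top)
  let ?K = "\<lambda>v n. total_variation (kappa_r_law (G n) (v n) (masked_wishart (G n) (d n)))
                  (kappa_r_law (G n) (v n) (masked_goe (G n)))"
  let ?T = "\<lambda>n. total_variation (masked_wishart (G n) (d n)) (masked_goe (G n))"
  have process: "?K v n \<le> ?T n" if "n \<ge> 1" "max_degree_vertex (G n) (v n)" for v n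
    unfolding kappa_r_law_def
  proof (rule total_variation_distr_le)
    show "kappa_r (G n) (v n) \<in> borel_measurable (masked_wishart (G n) (d n))"
      using measurable_kappa_r[OF simple_graph] that
      by (simp add: masked_wishart_def max_degree_vertex_def)
  qed (simp_all add: prob_space_masked_wishart prob_space_masked_goe, simp add: masked_wishart_def masked_goe_def)
  have T1: "?T n \<le> 1" for n
    by (rule total_variation_le_1[OF prob_space_masked_wishart prob_space_masked_goe])
  have lower: "\<forall>\<^sub>F n in sequentially. 1 - 2 * exp (1 / 2) / K - 32 * (real K)\<^sup>2 * r n \<le> ?K v n"
    if "K > 0" "\<forall>n\<ge>1. max_degree_vertex (G n) (v n)" for K :: nat and v
    using deg ge1
  proof eventually_elim
    case (elim n)
    then show ?case
      unfolding r_def using that by (intro total_variation_kappa_r_ge simple_graph d_pos) auto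
  qed
  have "?K v \<longlonglongrightarrow> 1" if v: "\<forall>n\<ge>1. max_degree_vertex (G n) (v n)" for v
  proof (rule tendsto_1_of_two_scale_bounds[OF r lower[OF _ v]])
    show "\<forall>\<^sub>F n in sequentially. ?K v n \<le> 1"
      using ge1 by eventually_elim (use process T1 v order_trans in blast)
  qed
  moreover have "?T \<longlonglongrightarrow> 1"
  proof -
    have "\<exists>v. max_degree_vertex (G n) v" if "n \<ge> 1" for n
    proof -
      have "maxdeg (G n) \<in> (\<lambda>v. card (neighbors (G n) v)) ` pverts (G n)"
        unfolding maxdeg_def using that by (intro Max_in) (auto simp: vertices)
      then show ?thesis by (auto simp: max_degree_vertex_def)
    qed
    then obtain v where v: "\<forall>n\<ge>1. max_degree_vertex (G n) (v n)" by metis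
    show ?thesis
    proof (rule tendsto_1_of_two_scale_bounds[OF r])
      fix K :: nat assume "K > 0"
      from lower[OF this v] ge1
      show "\<forall>\<^sub>F n in sequentially. 1 - 2 * exp (1 / 2) / K - 32 * (real K)\<^sup>2 * r n \<le> ?T n"
        by eventually_elim (use process v order_trans in blast)
    qed (simp add: T1)
  qed
  ultimately show ?thesis by blast
qed

end
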